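(* Let $\ell\ge1$ and let $\Psi:\mathcal M_\ell(\mathbb C)\to\mathcal M_\ell(\mathbb C)$ be the linear map $\Psi(X)=X+(\mathrm{Tr}X)I_\ell$. Let $Z=[\Psi\otimes\Psi](\omega_\ell)\in\mathcal M_{\ell^2}(\mathbb C)$. Then for all integers $n\ge1$, $$\sum_{\alpha,\beta\in\mathrm{Int}(n)}\ell^{\#(\alpha^{-1}\beta)}=\mathrm{Tr}[\omega_\ell Z^{n-1}]=\ell(2+2\ell)^{n-1}.$$
   Context: $\mathrm{Int}(n)$ is the set of interval partitions of $[n]$ (every block consists of consecutive integers), each identified with the permutation in $\mathcal S_n$ whose cycles are its blocks with elements in increasing order; $\#\sigma$ is the number of cycles of a permutation. For a fixed orthonormal basis $(e_i)$ of $\mathbb C^\ell$, $\Omega_\ell=\sum_i e_i\otimes e_i$ and $\omega_\ell=\Omega_\ell\Omega_\ell^*\in\mathcal M_{\ell^2}(\mathbb C)$. *)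

theory Defs
  imports
    "HOL-Analysis.Analysis"
    "HOL-Library.Disjoint_Sets"
    "HOL-Combinatorics.Cycles"
    "HOL-Combinatorics.Orbits"
begin

section \<open>Interval partitions and permutations\<close>

definition interval_partitions :: "nat \<Rightarrow> nat set set set" where
  "interval_partitions n = {P. partition_on {1..n} P \<and> (\<forall>B\<in>P. \<exists>a b. B = {a..b})}"

text \<open>
  The permutation whose cycles are the blocks of \<open>P\<close>, each traversed in increasing order and
  closed up cyclically (the list \<open>[a, b, c]\<close> gives \<open>a \<mapsto> b \<mapsto> c \<mapsto> a\<close>). As in \<open>permutes\<close>, points outside
  the ground set are fixed.
\<close>

definition partition_perm :: "nat set set \<Rightarrow> nat \<Rightarrow> nat" where
  "partition_perm P x =
     (if x \<in> \<Union>P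
      then cycle_of_list (sorted_list_of_set (THE B. B \<in> P \<and> x \<in> B)) x
      else x)"

text \<open>Fixed points in \<open>{1..n}\<close> count as cycles of length one.\<close>

definition num_cycles :: "nat \<Rightarrow> (nat \<Rightarrow> nat) \<Rightarrow> nat" where
  "num_cycles n \<sigma> = card (orbit \<sigma> ` {1..n})"

lemma finite_interval_partitions: "finite (interval_partitions n)"
proof -
  have "interval_partitions n \<subseteq> Pow (Pow {1..n})"
    by (auto simp: interval_partitions_def partition_on_def)
  then show ?thesis
    by (rule finite_subset) simp
qed

lemma partition_perm_block:
  assumes "partition_on A P" "B \<in> P" "x \<in> B"
  shows "partition_perm P x = cycle_of_list (sorted_list_of_set B) x"
proof -
  have "(THE B. B \<in> P \<and> x \<in> B) = B"
    using assms by (intro the_equality) (auto simp: partition_on_def disjoint_def)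
  then show ?thesis
    using assms by (auto simp: partition_perm_def)
qed

lemma partition_perm_permutes:
  assumes P: "partition_on A P" and A: "finite A"
  shows "partition_perm P permutes A"
proof (rule bij_imp_permutes)
  have UP: "\<Union>P = A"
    using P by (simp add: partition_on_def)
  have img: "partition_perm P ` B = B \<and> inj_on (partition_perm P) B" if B: "B \<in> P" for B
  proof -
    have "finite B"
      using B UP A by (meson Union_upper finite_subset)
    then have perm: "cycle_of_list (sorted_list_of_set B) permutes B"
      using cycle_permutes[of "sorted_list_of_set B"] by simp
    have eq: "partition_perm P x = cycle_of_list (sorted_list_of_set B) x" if "x \<in> B" for x
      using partition_perm_block[OF P B that] .
    have "partition_perm P ` B = cycle_of_list (sorted_list_of_set B) ` B"
      using eq by (intro image_cong) auto
    moreover have "inj_on (partition_perm P) B"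
      using permutes_inj_on[OF perm, of B] eq by (auto simp: inj_on_def)
    ultimately show ?thesis
      using permutes_image[OF perm] by simp
  qed
  have surj: "partition_perm P ` A = A"
    unfolding UP[symmetric] image_Union using img by auto
  then show "bij_betw (partition_perm P) A A"
    using A by (simp add: bij_betw_def finite_surj_inj)
  show "partition_perm P x = x" if "x \<notin> A" for x
    using that UP by (simp add: partition_perm_def)
qed

section \<open>Matrices and tensor products\<close>

definition is_orthonormal_basis :: "('l::finite \<Rightarrow> complex^'l) \<Rightarrow> bool" where
  "is_orthonormal_basis e \<longleftrightarrow>
     (\<forall>i j. (\<Sum>k\<in>UNIV. e i $ k * cnj (e j $ k)) = (if i = j then 1 else 0)) \<and>
     vec.span (range e) = UNIV"

text \<open>
  Throughout, $\mathbf{C}^\ell \otimes \mathbf{C}^\ell$ is the space of vectors indexed by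
  \<open>'l \<times> 'l\<close>, and $M_{\ell^2}$ is the space of matrices indexed in the same way.
\<close>

definition tensor_vec :: "complex^'l \<Rightarrow> complex^'m \<Rightarrow> complex^('l \<times> 'm)" where
  "tensor_vec u v = (\<chi> p. u $ fst p * v $ snd p)"

definition tensor_mat ::
  "complex^'l^'l \<Rightarrow> complex^'m^'m \<Rightarrow> complex^('l \<times> 'm)^('l \<times> 'm)" where
  "tensor_mat A B = (\<chi> p q. A $ fst p $ fst q * B $ snd p $ snd q)"

definition mat_unit :: "'l::finite \<Rightarrow> 'l \<Rightarrow> complex^'l^'l" where
  "mat_unit i j = (\<chi> a b. if a = i \<and> b = j then 1 else 0)"

text \<open>
  The map \<open>\<Phi> \<otimes> \<Psi>\<close> for linear \<open>\<Phi>\<close>, \<open>\<Psi>\<close>: the linear extension of \<open>A \<otimes> B \<mapsto> \<Phi>(A) \<otimes> \<Psi>(B)\<close> from the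
  basis of tensor products of matrix units. Lemma \<open>tensor_map_tensor_mat\<close> below shows that it acts
  in this way on all elementary tensors.
\<close>

definition tensor_map ::
  "(complex^'l::finite^'l \<Rightarrow> complex^'l^'l) \<Rightarrow> (complex^'l^'l \<Rightarrow> complex^'l^'l) \<Rightarrow>
   complex^('l \<times> 'l)^('l \<times> 'l) \<Rightarrow> complex^('l \<times> 'l)^('l \<times> 'l)" where
  "tensor_map \<Phi> \<Psi> X =
     (\<chi> p q. \<Sum>i\<in>UNIV. \<Sum>j\<in>UNIV. \<Sum>k\<in>UNIV. \<Sum>m\<in>UNIV.
        X $ (i, k) $ (j, m) * tensor_mat (\<Phi> (mat_unit i j)) (\<Psi> (mat_unit k m)) $ p $ q)"

definition Omega :: "('l::finite \<Rightarrow> complex^'l) \<Rightarrow> complex^('l \<times> 'l)" where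
  "Omega e = (\<Sum>i\<in>UNIV. tensor_vec (e i) (e i))"

text \<open>\<open>\<Omega> \<Omega>\<^sup>*\<close>, where \<open>\<Omega>\<^sup>*\<close> is the conjugate transpose.\<close>

definition omega :: "('l::finite \<Rightarrow> complex^'l) \<Rightarrow> complex^('l \<times> 'l)^('l \<times> 'l)" where
  "omega e = (\<chi> p q. Omega e $ p * cnj (Omega e $ q))"

text \<open>The library's \<open>^\<close> on \<open>complex^'m^'m\<close> would be the entrywise power.\<close>

primrec mat_power :: "complex^'m^'m \<Rightarrow> nat \<Rightarrow> complex^'m^'m" where
  "mat_power A 0 = mat 1"
| "mat_power A (Suc k) = A ** mat_power A k"

text \<open>\<open>mat c\<close> is the scalar matrix \<open>c I\<close>.\<close>

definition Psi :: "complex^'l^'l \<Rightarrow> complex^'l^'l" where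
  "Psi X = X + mat (trace X)"

definition mat_linear :: "(complex^'l^'l \<Rightarrow> complex^'l^'l) \<Rightarrow> bool" where
  "mat_linear \<Phi> \<longleftrightarrow>
     (\<forall>X Y. \<Phi> (X + Y) = \<Phi> X + \<Phi> Y) \<and> (\<forall>c X. \<Phi> (mat c ** X) = mat c ** \<Phi> X)"

lemma mat_scalar_nth: "(mat c ** (X :: complex^'l^'l)) $ i $ j = c * X $ i $ j"
  by (simp add: matrix_matrix_mult_def mat_def if_distrib[of "\<lambda>x. x * _"] cong: if_cong)

lemma mat_linear_Psi: "mat_linear (Psi :: complex^'l^'l \<Rightarrow> _)"
proof -
  have mat_nth: "(mat c :: complex^'l^'l) $ i $ j = (if i = j then c else 0)" for c i j
    by (simp add: mat_def)
  have tr: "trace (mat c ** X) = c * trace X" for c and X :: "complex^'l^'l"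
    unfolding trace_def mat_scalar_nth by (simp add: sum_distrib_left)
  have "Psi (X + Y) = Psi X + Psi Y" for X Y :: "complex^'l^'l"
    unfolding Psi_def vec_eq_iff by (simp add: mat_nth trace_add)
  moreover have "Psi (mat c ** X) = mat c ** Psi X" for c and X :: "complex^'l^'l"
    unfolding Psi_def vec_eq_iff
    by (simp only: vector_add_component mat_scalar_nth tr mat_nth) (simp add: distrib_left)
  ultimately show ?thesis
    by (simp add: mat_linear_def)
qed

lemma mat_linear_expand:
  fixes A :: "complex^'l::finite^'l"
  assumes "mat_linear \<Phi>"
  shows "\<Phi> A $ a $ b = (\<Sum>i\<in>UNIV. \<Sum>j\<in>UNIV. A $ i $ j * \<Phi> (mat_unit i j) $ a $ b)"
proof -
  have add: "\<Phi> (X + Y) = \<Phi> X + \<Phi> Y" and scale: "\<Phi> (mat c ** X) = mat c ** \<Phi> X" for X Y c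
    using assms by (auto simp: mat_linear_def)
  have zero: "\<Phi> 0 = 0"
    using add[of 0 0] by simp
  have sum: "\<Phi> (sum f S) = (\<Sum>x\<in>S. \<Phi> (f x))" if "finite S"
    for f :: "'l \<Rightarrow> complex^'l^'l" and S
    using that by (induction S rule: finite_induct) (auto simp: add zero)
  have "A = (\<Sum>i\<in>UNIV. \<Sum>j\<in>UNIV. mat (A $ i $ j) ** mat_unit i j)"
  proof -
    have "(\<Sum>i\<in>UNIV. \<Sum>j\<in>UNIV. A $ i $ j * (if x = i \<and> y = j then 1 else 0)) = A $ x $ y"
      for x y
    proof -
      have "(\<Sum>j\<in>UNIV. A $ i $ j * (if x = i \<and> y = j then 1 else 0))
              = (if x = i then A $ i $ y else 0)" for i
        by (cases "x = i") (simp_all add: if_distrib cong: if_cong)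
      then show ?thesis
        by simp
    qed
    then show ?thesis
      by (simp add: vec_eq_iff mat_scalar_nth mat_unit_def)
  qed
  then have "\<Phi> A = (\<Sum>i\<in>UNIV. \<Sum>j\<in>UNIV. mat (A $ i $ j) ** \<Phi> (mat_unit i j))"
    by (metis (no_types, lifting) sum scale finite_code sum.cong)
  then show ?thesis
    by (simp add: mat_scalar_nth)
qed

lemma sum_sum_product:
  fixes f g F G :: "'l::finite \<Rightarrow> 'l \<Rightarrow> complex"
  shows "(\<Sum>i\<in>UNIV. \<Sum>j\<in>UNIV. \<Sum>k\<in>UNIV. \<Sum>m\<in>UNIV.
            (f i j * g k m) * (F i j * G k m)) =
         (\<Sum>i\<in>UNIV. \<Sum>j\<in>UNIV. f i j * F i j) * (\<Sum>k\<in>UNIV. \<Sum>m\<in>UNIV. g k m * G k m)"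
  unfolding sum_distrib_right unfolding sum_distrib_left by (simp add: mult_ac)

lemma tensor_map_tensor_mat:
  assumes "mat_linear \<Phi>" "mat_linear \<Psi>"
  shows "tensor_map \<Phi> \<Psi> (tensor_mat A B) = tensor_mat (\<Phi> A) (\<Psi> B)"
  by (simp add: vec_eq_iff tensor_map_def tensor_mat_def sum_sum_product
      mat_linear_expand[OF assms(1), of A] mat_linear_expand[OF assms(2), of B])

end

theory Submission
  imports Defs
begin

text \<open>
  An interval partition of $[n+1]$ arises from one of $[n]$ either by adding the block $\{n+1\}$,
  which leaves the permutation $\alpha$ unchanged, or by enlarging the last block, which replaces it
  by $\alpha\tau$ with $\tau = (n\ n{+}1)$. So each pair $(\alpha, \beta)$ yields $\sigma$,
  $\tau\sigma$, $\sigma\tau$ and $\tau\sigma\tau$, where $\sigma = \alpha^{-1}\beta$. The first and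
  the last have one more cycle than $\sigma$ on $[n]$, the other two equally many, and the sum is
  multiplied by $2 + 2\ell$.

  On the matrix side, the coefficient matrix of $\Omega_\ell$ is unitary, so both partial traces of
  $\omega_\ell$ are the identity and $Z = \omega_\ell + (2 + \ell) I$. As
  $\omega_\ell^2 = \ell\omega_\ell$, multiplication by $Z$ scales $\omega_\ell$ by $2 + 2\ell$.
\<close>

section \<open>Cycle counts of interval partitions\<close>

lemma cycle_of_list_upt:
  assumes "a \<le> b" "x \<in> {a..b}"
  shows "cycle_of_list [a..<Suc b] x = (if x = b then a else Suc x)"
  using assms
proof (induction "b - a" arbitrary: a x)
  case 0
  then show ?case by simp
next
  case (Suc d)
  then have ab: "a < b" by simp
  have upt: "[a..<Suc b] = a # Suc a # [Suc (Suc a)..<Suc b]"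
    using ab by (simp add: upt_conv_Cons del: upt_Suc)
  \<comment> \<open>The transposition acts after the cycle on the remaining points: it sends the
    fixed point \<open>a\<close> to \<open>Suc a\<close>, turns the image \<open>Suc a\<close> of
    \<open>b\<close> into \<open>a\<close>, and leaves the images of all other points alone.\<close>
  have step: "cycle_of_list [a..<Suc b] x = Transposition.transpose a (Suc a) (cycle_of_list [Suc a..<Suc b] x)"
    using ab by (simp add: upt upt_conv_Cons del: upt_Suc)
  show ?case
  proof (cases "x = a")
    case True
    have "cycle_of_list [Suc a..<Suc b] a = a"
      by (rule id_outside_supp) simp
    then show ?thesis using step True ab by simp
  next
    case False
    then have x: "x \<in> {Suc a..b}" "Suc a \<le> b" "d = b - Suc a" using Suc by auto
    show ?thesis
      using Suc(1)[OF x(3) x(2) x(1)] step False x by (auto simp: Transposition.transpose_def)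
  qed
qed

lemma partition_perm_interval:
  assumes "partition_on A P" "{a..b} \<in> P" "x \<in> {a..b}"
  shows "partition_perm P x = (if x = b then a else Suc x)"
proof -
  have "sorted_list_of_set {a..b} = [a..<Suc b]"
    using sorted_list_of_set_range[of a "Suc b"]
    by (simp add: atLeastLessThanSuc_atLeastAtMost del: upt_Suc)
  then show ?thesis
    using partition_perm_block[OF assms] cycle_of_list_upt[of a b x] assms(3) by simp
qed

section \<open>Cycle counts under conjugation and multiplication by a transposition\<close>

lemma orbit_conj:
  assumes "bij \<tau>"
  shows "orbit (\<tau> \<circ> \<sigma> \<circ> inv \<tau>) (\<tau> x) = \<tau> ` orbit \<sigma> x"
proof -
  have inv: "inv \<tau> (\<tau> y) = y" for y
    using assms by (simp add: bij_is_inj)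
  have pow: "((\<tau> \<circ> \<sigma> \<circ> inv \<tau>) ^^ k) (\<tau> x) = \<tau> ((\<sigma> ^^ k) x)" for k
    by (induction k) (simp_all add: inv)
  show ?thesis
    by (auto simp: orbit_altdef pow)
qed

text \<open>Conjugation by \<tau> replaces each orbit by its image under \<tau>. As \<tau> is a
  bijection, distinct orbits have distinct images.\<close>

lemma num_cycles_conj:
  assumes "\<tau> permutes {1..n}"
  shows "num_cycles n (\<tau> \<circ> \<sigma> \<circ> inv \<tau>) = num_cycles n \<sigma>"
proof -
  have bij: "bij \<tau>" using assms by (rule permutes_bij)
  have "orbit (\<tau> \<circ> \<sigma> \<circ> inv \<tau>) ` {1..n} = orbit (\<tau> \<circ> \<sigma> \<circ> inv \<tau>) ` \<tau> ` {1..n}"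
    using permutes_image[OF assms] by simp
  also have "\<dots> = (`) \<tau> ` orbit \<sigma> ` {1..n}"
    using orbit_conj[OF bij] by (simp add: image_image)
  finally have "num_cycles n (\<tau> \<circ> \<sigma> \<circ> inv \<tau>) = card ((`) \<tau> ` orbit \<sigma> ` {1..n})"
    by (simp add: num_cycles_def)
  moreover have "inj ((`) \<tau>)"
    unfolding inj_def using inj_image_eq_iff[OF bij_is_inj[OF bij]] by blast
  then have "inj_on ((`) \<tau>) (orbit \<sigma> ` {1..n})"
    by (rule inj_on_subset) simp
  ultimately show ?thesis
    by (simp add: num_cycles_def card_image)
qed

text \<open>The point \<open>Suc n\<close> is a cycle of its own, while the orbits of the other
  points stay inside \<open>{1..n}\<close>.\<close>

lemma num_cycles_Suc_fixed:
  assumes "\<sigma> permutes {1..n}"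
  shows "num_cycles (Suc n) \<sigma> = Suc (num_cycles n \<sigma>)"
proof -
  have "\<sigma> (Suc n) = Suc n"
    using assms by (rule permutes_not_in) simp
  then have "Suc n \<in> orbit \<sigma> (Suc n)"
    by (metis orbit.base)
  moreover have "Suc n \<notin> orbit \<sigma> x" if "x \<in> {1..n}" for x
    using permutes_orbit_subset[OF assms that] by auto
  ultimately have "orbit \<sigma> (Suc n) \<notin> orbit \<sigma> ` {1..n}"
    by force
  then show ?thesis
    by (simp add: num_cycles_def atLeastAtMostSuc_conv)
qed

text \<open>The composition inserts \<open>Suc n\<close> into the cycle of \<open>n\<close>,
  directly after \<open>n\<close>. Intersecting with \<open>{1..n}\<close> therefore matches the new
  orbits with the old ones.\<close>

lemma num_cycles_comp_transpose:
  assumes \<sigma>: "\<sigma> permutes {1..n}" and n: "n \<ge> 1"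
  shows "num_cycles (Suc n) (\<sigma> \<circ> Transposition.transpose n (Suc n)) = num_cycles n \<sigma>"
proof -
  define \<rho> where "\<rho> = \<sigma> \<circ> Transposition.transpose n (Suc n)"
  have fix_Suc: "\<sigma> (Suc n) = Suc n"
    using \<sigma> by (rule permutes_not_in) simp
  have \<rho>x: "\<rho> x = \<sigma> x" if "x \<notin> {n, Suc n}" for x
    using that by (auto simp: \<rho>_def fix_Suc)
  have \<rho>n: "\<rho> n = Suc n" "\<rho> (Suc n) = \<sigma> n"
    by (auto simp: \<rho>_def fix_Suc)
  have "\<sigma> permutes {1..Suc n}"
    using \<sigma> by (rule permutes_subset) auto
  then have \<rho>: "\<rho> permutes {1..Suc n}"
    unfolding \<rho>_def using n by (intro permutes_compose permutes_swap_id) auto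
  then have perm: "permutation \<rho>"
    by (auto simp: permutation_permutes)
  have cyc: "cyclic_on \<rho> (orbit \<rho> x)" for x
    using perm by (rule cyclic_on_orbit')
  have self: "x \<in> orbit \<rho> x" for x
    using perm by (rule permutation_self_in_orbit)
  have eq: "orbit \<rho> y = orbit \<rho> x" if "y \<in> orbit \<rho> x" for x y
    using orbit_cyclic_eq3[OF cyc that] .
  have sub: "orbit \<sigma> x \<subseteq> orbit \<rho> x" for x
  proof
    \<comment> \<open>One step of \<sigma> is one step of \<rho>, except at \<open>n\<close>, where
      it takes two steps via \<open>Suc n\<close>, and at \<open>Suc n\<close>, where \<sigma> does
      not move.\<close>
    have \<sigma>_in: "\<sigma> y \<in> orbit \<rho> y" for y
    proof -
      consider "y = n" | "y = Suc n" | "y \<notin> {n, Suc n}" by blast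
      then show ?thesis
      proof cases
        case 1
        then show ?thesis using orbit.step[OF orbit.base[of \<rho> n]] \<rho>n by simp
      next
        case 2
        then show ?thesis using self fix_Suc by simp
      next
        case 3
        then show ?thesis using orbit.base[of \<rho> y] \<rho>x by simp
      qed
    qed
    fix y assume "y \<in> orbit \<sigma> x"
    then show "y \<in> orbit \<rho> x"
      by induction (use \<sigma>_in eq in blast)+
  qed
  have sup: "orbit \<rho> x \<inter> {1..n} \<subseteq> orbit \<sigma> x" if x: "x \<in> {1..n}" for x
  proof -
    \<comment> \<open>The second alternative is the detour through \<open>Suc n\<close>. It records
      that \<open>n\<close> is in the old orbit, so the next point, \<sigma> applied to
      \<open>n\<close>, is in it again.\<close>
    have "y \<in> orbit \<sigma> x \<or> y = Suc n \<and> n \<in> orbit \<sigma> x" if "y \<in> orbit \<rho> x" for y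
      using that
    proof induction
      case base
      have "x \<in> orbit \<sigma> x"
        using \<sigma> by (intro permutation_self_in_orbit) (auto simp: permutation_permutes)
      then show ?case
        using \<rho>n \<rho>x[of x] x by (cases "x = n") (auto intro: orbit.base)
    next
      case (step y)
      have "y \<noteq> Suc n" if "y \<in> orbit \<sigma> x"
        using permutes_orbit_subset[OF \<sigma> x] that by auto
      then show ?case
        using step \<rho>n \<rho>x[of y] by (cases "y = n") (auto intro: orbit.step)
    qed
    then show ?thesis by fastforce
  qed
  have trace: "orbit \<rho> x \<inter> {1..n} = orbit \<sigma> x" if "x \<in> {1..n}" for x
    using sub sup permutes_orbit_subset[OF \<sigma> that] that by blast
  have "orbit \<rho> (Suc n) = orbit \<rho> n"
    using eq orbit.base[of \<rho> n] \<rho>n by simp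
  then have "orbit \<rho> ` {1..Suc n} = orbit \<rho> ` {1..n}"
    using n by (auto simp: atLeastAtMostSuc_conv)
  \<comment> \<open>Each of these orbits contains a point of \<open>{1..n}\<close>, and orbits that
    share a point coincide.\<close>
  moreover have "inj_on (\<lambda>V. V \<inter> {1..n}) (orbit \<rho> ` {1..n})"
    by (rule inj_onI) (use eq self in blast)
  moreover have "(\<lambda>V. V \<inter> {1..n}) ` orbit \<rho> ` {1..n} = orbit \<sigma> ` {1..n}"
    using trace by (simp add: image_image)
  ultimately show ?thesis
    unfolding num_cycles_def \<rho>_def[symmetric] by (metis card_image)
qed

text \<open>The permutations \<tau>\<sigma> and \<sigma>\<tau> are conjugate under \<tau>.\<close>

lemma num_cycles_transpose_comp:
  assumes \<sigma>: "\<sigma> permutes {1..n}" and n: "n \<ge> 1"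
  shows "num_cycles (Suc n) (Transposition.transpose n (Suc n) \<circ> \<sigma>) = num_cycles n \<sigma>"
proof -
  let ?\<tau> = "Transposition.transpose n (Suc n)"
  have "?\<tau> permutes {1..Suc n}"
    using n by (intro permutes_swap_id) auto
  then have "num_cycles (Suc n) (?\<tau> \<circ> (\<sigma> \<circ> ?\<tau>) \<circ> inv ?\<tau>) = num_cycles (Suc n) (\<sigma> \<circ> ?\<tau>)"
    by (rule num_cycles_conj)
  then show ?thesis
    using num_cycles_comp_transpose[OF assms] by (simp add: comp_assoc)
qed

section \<open>Recursive structure of interval partitions\<close>

lemma interval_partitions_D:
  assumes "P \<in> interval_partitions n"
  shows "partition_on {1..n} P" "\<And>B. B \<in> P \<Longrightarrow> \<exists>a b. B = {a..b}"
  using assms by (auto simp: interval_partitions_def)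

lemma Suc_notin_interval_block:
  assumes "P \<in> interval_partitions n" "B \<in> P"
  shows "Suc n \<notin> B"
proof -
  have "Suc n \<notin> \<Union>P"
    unfolding partition_onD1[OF interval_partitions_D(1)[OF assms(1)], symmetric] by simp
  then show ?thesis using assms(2) by blast
qed

text \<open>The block that contains \<open>n\<close> is an interval inside \<open>{1..n}\<close>, so
  it cannot end elsewhere.\<close>

lemma last_block:
  assumes "P \<in> interval_partitions n" "n \<ge> 1"
  obtains a where "{a..n} \<in> P" "1 \<le> a" "a \<le> n"
proof -
  note P = interval_partitions_D[OF assms(1)]
  have U: "\<Union>P = {1..n}" using P(1) by (simp add: partition_on_def)
  have "n \<in> \<Union>P" using U assms(2) by simp
  then obtain B where B: "B \<in> P" "n \<in> B" by blast
  obtain a b where ab: "B = {a..b}" using P(2)[OF B(1)] by blast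
  then have "a \<le> n" "n \<le> b" using B by auto
  moreover have "B \<subseteq> {1..n}" using U B by blast
  then have "a \<in> {1..n}" "b \<in> {1..n}" using ab calculation by auto
  ultimately have "b = n" by simp
  then show ?thesis using that[of a] B ab \<open>a \<in> {1..n}\<close> by simp
qed

definition append_block :: "nat \<Rightarrow> nat set set \<Rightarrow> nat set set" where
  "append_block n P = insert {Suc n} P"

text \<open>The last block is recognised by containing \<open>n\<close>, so mapping over all blocks
  avoids having to select it.\<close>

definition extend_last_block :: "nat \<Rightarrow> nat set set \<Rightarrow> nat set set" where
  "extend_last_block n P = (\<lambda>B. if n \<in> B then insert (Suc n) B else B) ` P"

lemma append_block_in:
  assumes "P \<in> interval_partitions n"
  shows "append_block n P \<in> interval_partitions (Suc n)"
proof -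
  note P = interval_partitions_D[OF assms]
  have "partition_on {1..Suc n} (append_block n P)"
  proof -
    have "{1..Suc n} - {Suc n} = {1..n}" by auto
    moreover have "disjnt {Suc n} (\<Union>P)"
      using Suc_notin_interval_block[OF assms] by (auto simp: disjnt_def)
    ultimately show ?thesis
      using P(1) by (simp add: append_block_def partition_on_insert)
  qed
  moreover have "\<exists>a b. {Suc n} = {a..b}" by (metis atLeastAtMost_singleton)
  ultimately show ?thesis
    using P(2) by (auto simp: interval_partitions_def append_block_def)
qed

lemma extend_last_block_in:
  assumes "P \<in> interval_partitions n" "n \<ge> 1"
  shows "extend_last_block n P \<in> interval_partitions (Suc n)"
proof -
  note P = interval_partitions_D[OF assms(1)]
  have U: "\<Union>P = {1..n}" using P(1) by (simp add: partition_on_def)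
  have "partition_on {1..Suc n} (extend_last_block n P)"
  proof (rule partition_onI)
    show "\<Union>(extend_last_block n P) = {1..Suc n}"
    proof -
      obtain a where a: "{a..n} \<in> P" "a \<le> n" using last_block[OF assms] by blast
      then have "n \<in> {a..n}" by simp
      then have "\<Union>(extend_last_block n P) = insert (Suc n) (\<Union>P)"
        unfolding extend_last_block_def using a(1) by auto
      then show ?thesis using U by (simp add: atLeastAtMostSuc_conv)
    qed
    show "{} \<notin> extend_last_block n P"
    proof
      assume "{} \<in> extend_last_block n P"
      then obtain B where "B \<in> P" "{} = (if n \<in> B then insert (Suc n) B else B)"
        unfolding extend_last_block_def by (rule imageE)
      then have "{} \<in> P" by (simp split: if_splits)
      then show False using P(1) by (simp add: partition_on_def)
    qed
    fix p q assume pq: "p \<in> extend_last_block n P" "q \<in> extend_last_block n P" "p \<noteq> q"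
    obtain B where B: "B \<in> P" "p = (if n \<in> B then insert (Suc n) B else B)"
      using pq(1) unfolding extend_last_block_def by (rule imageE)
    obtain C where C: "C \<in> P" "q = (if n \<in> C then insert (Suc n) C else C)"
      using pq(2) unfolding extend_last_block_def by (rule imageE)
    have "Suc n \<notin> B" "Suc n \<notin> C"
      using Suc_notin_interval_block[OF assms(1)] B(1) C(1) by blast+
    moreover have "B \<inter> C = {}"
      using partition_onD2[OF P(1)] B C pq(3) by (auto dest: disjointD)
    ultimately show "disjnt p q"
      using B(2) C(2) by (auto simp: disjnt_def)
  qed
  \<comment> \<open>A block containing \<open>n\<close> ends at \<open>n\<close>, so
    \<open>Suc n\<close> is its next point.\<close>
  moreover have "\<exists>a b. insert (Suc n) B = {a..b}" if B: "B \<in> P" "n \<in> B" for B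
  proof -
    obtain a b where ab: "B = {a..b}" using P(2)[OF B(1)] by blast
    have "B \<subseteq> {1..n}" using U B by blast
    moreover have "b \<in> B" using B ab by auto
    ultimately have "b \<le> n" by auto
    moreover have "n \<le> b" using B ab by simp
    ultimately have "b = n" by simp
    then have "insert (Suc n) B = {a..Suc n}" using ab B by auto
    then show ?thesis by blast
  qed
  ultimately show ?thesis
    using P(2) by (auto simp: interval_partitions_def extend_last_block_def)
qed

lemma append_block_eq_iff:
  assumes "P \<in> interval_partitions n" "Q \<in> interval_partitions n"
  shows "append_block n P = append_block n Q \<longleftrightarrow> P = Q"
proof -
  have "{Suc n} \<notin> R" if "R \<in> interval_partitions n" for R
    using Suc_notin_interval_block[OF that] by blast
  then show ?thesis
    using assms by (metis append_block_def insert_ident)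
qed

text \<open>Deleting \<open>Suc n\<close> from every block is a left inverse of the extension. This
  gives injectivity.\<close>

lemma extend_last_block_restrict:
  assumes "P \<in> interval_partitions n"
  shows "(\<lambda>B. B - {Suc n}) ` extend_last_block n P = P"
proof -
  have "B - {Suc n} = B" if "B \<in> P" for B
    using Suc_notin_interval_block[OF assms that] by simp
  then have "(if n \<in> B then insert (Suc n) B else B) - {Suc n} = B" if "B \<in> P" for B
    using that by auto
  then show ?thesis
    unfolding extend_last_block_def image_image by simp
qed

text \<open>Otherwise deleting \<open>Suc n\<close> would leave an empty block in \<open>P\<close>.
  This keeps the images of the two constructions apart.\<close>

lemma singleton_notin_extend_last_block:
  assumes "P \<in> interval_partitions n"
  shows "{Suc n} \<notin> extend_last_block n P"
proof
  assume "{Suc n} \<in> extend_last_block n P"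
  then have "{Suc n} - {Suc n} \<in> P"
    using extend_last_block_restrict[OF assms] by (metis (no_types, lifting) image_eqI)
  then show False
    using interval_partitions_D(1)[OF assms] by (simp add: partition_on_def)
qed

text \<open>The block \<open>{a..Suc n}\<close> decides the case: for \<open>a = Suc n\<close> it
  was appended; otherwise it also contains \<open>n\<close>, and deleting \<open>Suc n\<close>
  undoes an extension.\<close>

lemma interval_partitions_Suc_cases:
  assumes Q: "Q \<in> interval_partitions (Suc n)" and n: "n \<ge> 1"
  shows "Q \<in> append_block n ` interval_partitions n \<union> extend_last_block n ` interval_partitions n"
proof -
  note Q' = interval_partitions_D[OF Q]
  have U: "\<Union>Q = {1..Suc n}" and ne: "{} \<notin> Q"
    and dj: "\<And>B C. B \<in> Q \<Longrightarrow> C \<in> Q \<Longrightarrow> B \<noteq> C \<Longrightarrow> B \<inter> C = {}"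
    using Q'(1) by (auto simp: partition_on_def disjoint_def)
  obtain a where a: "{a..Suc n} \<in> Q" "1 \<le> a" "a \<le> Suc n"
    using last_block[OF Q] by auto
  show ?thesis
  proof (cases "a = Suc n")
    case True
    then have s: "{Suc n} \<in> Q" using a by simp
    define P where "P = Q - {{Suc n}}"
    have "\<Union>P = {1..n}"
    proof -
      have "\<Union>P = \<Union>Q - {Suc n}" using dj[OF _ s] by (fastforce simp: P_def)
      then show ?thesis using U by (auto simp: atLeastAtMostSuc_conv)
    qed
    then have "P \<in> interval_partitions n"
      using Q' by (auto simp: interval_partitions_def partition_on_def P_def disjoint_def)
    moreover have "Q = append_block n P"
      using s by (auto simp: append_block_def P_def)
    ultimately show ?thesis by blast
  next
    case False
    then have an: "a \<le> n" using a by simp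
    have block: "B = {a..Suc n}" if "B \<in> Q" "n \<in> B \<or> Suc n \<in> B" for B
    proof (rule ccontr)
      assume "B \<noteq> {a..Suc n}"
      then have "B \<inter> {a..Suc n} = {}" by (rule dj[OF that(1) a(1)])
      moreover have "n \<in> {a..Suc n}" "Suc n \<in> {a..Suc n}" using an by auto
      ultimately show False using that(2) by blast
    qed
    define P where "P = (\<lambda>B. B - {Suc n}) ` Q"
    have Uni: "\<Union>P = {1..n}"
      using U by (auto simp: P_def atLeastAtMostSuc_conv)
    have "{} \<notin> P"
    proof
      assume "{} \<in> P"
      then obtain B where B: "B \<in> Q" "B - {Suc n} = {}" by (auto simp: P_def)
      then have "B = {Suc n}" using ne by (metis Diff_eq_empty_iff subset_singletonD)
      then have "{Suc n} = {a..Suc n}" using block[OF B(1)] by simp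
      moreover have "n \<in> {a..Suc n}" using an by simp
      ultimately show False by (metis n_not_Suc_n singletonD)
    qed
    moreover have "disjoint P"
    proof (rule disjointI)
      fix p q assume pq: "p \<in> P" "q \<in> P" "p \<noteq> q"
      obtain B where B: "B \<in> Q" "p = B - {Suc n}" using pq(1) unfolding P_def by (rule imageE)
      obtain C where C: "C \<in> Q" "q = C - {Suc n}" using pq(2) unfolding P_def by (rule imageE)
      have "B \<noteq> C" using B C pq(3) by blast
      then show "p \<inter> q = {}" using dj[OF B(1) C(1)] B(2) C(2) by blast
    qed
    moreover have "\<exists>c d. B - {Suc n} = {c..d}" if B: "B \<in> Q" for B
    proof (cases "Suc n \<in> B")
      case True
      then have "B - {Suc n} = {a..n}" using block[OF B] by auto
      then show ?thesis by blast
    next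
      case False
      then show ?thesis using Q'(2)[OF B] by simp
    qed
    ultimately have "P \<in> interval_partitions n"
      using Uni by (auto simp: interval_partitions_def partition_on_def P_def)
    moreover have "Q = extend_last_block n P"
    proof -
      \<comment> \<open>Only the last block contains \<open>n\<close>, so \<open>Suc n\<close> is
        put back exactly where it was deleted.\<close>
      have "(if n \<in> B - {Suc n} then insert (Suc n) (B - {Suc n}) else B - {Suc n}) = B" if "B \<in> Q" for B
        using block[OF that] an by auto
      then show ?thesis
        unfolding extend_last_block_def P_def image_image by simp
    qed
    ultimately show ?thesis by blast
  qed
qed

text \<open>Both constructions are injective, and their disjoint images exhaust the interval
  partitions of \<open>{1..Suc n}\<close>.\<close>

lemma sum_interval_partitions_Suc:
  fixes f :: "nat set set \<Rightarrow> 'a::comm_monoid_add"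
  assumes n: "n \<ge> 1"
  shows "(\<Sum>P\<in>interval_partitions (Suc n). f P) =
         (\<Sum>P\<in>interval_partitions n. f (append_block n P) + f (extend_last_block n P))"
proof -
  let ?I = "interval_partitions n"
  have eq: "interval_partitions (Suc n) = append_block n ` ?I \<union> extend_last_block n ` ?I"
    using interval_partitions_Suc_cases[OF _ n] append_block_in extend_last_block_in[OF _ n] by blast
  have "append_block n ` ?I \<inter> extend_last_block n ` ?I = {}"
    using singleton_notin_extend_last_block by (auto simp: append_block_def)
  moreover have "inj_on (append_block n) ?I"
    by (auto simp: inj_on_def append_block_eq_iff)
  moreover have "inj_on (extend_last_block n) ?I"
    by (rule inj_on_inverseI[where g = "\<lambda>Q. (\<lambda>B. B - {Suc n}) ` Q"]) (rule extend_last_block_restrict)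
  ultimately show ?thesis
    by (simp add: eq sum.union_disjoint finite_interval_partitions sum.reindex sum.distrib)
qed

lemma interval_partitions_1: "interval_partitions 1 = {{{1}}}"
proof -
  have "P = {{1}}" if "P \<in> interval_partitions 1" for P
  proof -
    have "\<Union>P = {1}" "{} \<notin> P"
      using interval_partitions_D(1)[OF that] by (auto simp: partition_on_def)
    moreover have "B = {1}" if "B \<in> P" for B
    proof -
      have "B \<subseteq> {1}" using calculation(1) that by blast
      then show ?thesis using calculation(2) that by (metis subset_singletonD)
    qed
    ultimately show ?thesis by auto
  qed
  moreover have "{{1}} \<in> interval_partitions 1"
  proof -
    have "\<exists>a b. {1} = {a..b::nat}"
      by (metis atLeastAtMost_singleton)
    then show ?thesis
      by (simp add: interval_partitions_def partition_on_def disjoint_def)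
  qed
  ultimately show ?thesis by blast
qed

section \<open>Permutations of the appended and extended partitions\<close>

lemma partition_perm_append_block:
  assumes "P \<in> interval_partitions n"
  shows "partition_perm (append_block n P) = partition_perm P"
proof
  fix x
  note P = interval_partitions_D(1)[OF assms] and Q = interval_partitions_D(1)[OF append_block_in[OF assms]]
  show "partition_perm (append_block n P) x = partition_perm P x"
  proof (cases "x \<in> {1..n}")
    case True
    then obtain B where "B \<in> P" "x \<in> B" using partition_onD1[OF P] by blast
    then show ?thesis
      using partition_perm_block[OF P] partition_perm_block[OF Q] by (simp add: append_block_def)
  next
    case False
    have "partition_perm (append_block n P) x = x"
    proof (cases "x = Suc n")
      case True
      then show ?thesis using partition_perm_block[OF Q, of "{Suc n}" x] by (simp add: append_block_def)
    next
      case ne: False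
      then show ?thesis
        using partition_perm_permutes[OF Q] False by (intro permutes_not_in) auto
    qed
    then show ?thesis
      using permutes_not_in[OF partition_perm_permutes[OF P finite_atLeastAtMost]] False by simp
  qed
qed

text \<open>Only the last block changes. On the right-hand side \<open>n\<close> goes to the fixed
  point \<open>Suc n\<close> of \<open>partition_perm P\<close>, and \<open>Suc n\<close> goes via
  \<open>n\<close> to the left end of the block, which is how the enlarged cycle closes.\<close>

lemma partition_perm_extend_last_block:
  assumes "P \<in> interval_partitions n" "n \<ge> 1"
  shows "partition_perm (extend_last_block n P) = partition_perm P \<circ> Transposition.transpose n (Suc n)"
proof
  fix x
  note P = interval_partitions_D(1)[OF assms(1)]
    and Q = interval_partitions_D(1)[OF extend_last_block_in[OF assms]]
  have PS: "partition_perm P x = x" if "x \<notin> {1..n}" for x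
    by (rule permutes_not_in[OF partition_perm_permutes[OF P finite_atLeastAtMost] that])
  obtain a where a: "{a..n} \<in> P" "1 \<le> a" "a \<le> n"
    using last_block[OF assms] by blast
  have ins: "insert (Suc n) {a..n} = {a..Suc n}" using a by auto
  then have b: "{a..Suc n} \<in> extend_last_block n P"
    unfolding extend_last_block_def using a by (intro image_eqI[of _ _ "{a..n}"]) auto
  \<comment> \<open>The cases are the enlarged block, the unchanged blocks, and the points outside
    the ground set.\<close>
  consider "x \<in> {a..Suc n}" | "x \<in> {1..n}" "x \<notin> {a..n}" | "x \<notin> {1..Suc n}"
  proof -
    have "x \<in> {a..Suc n} \<or> x \<in> {1..n} \<and> x \<notin> {a..n} \<or> x \<notin> {1..Suc n}"
      using a by auto
    then show thesis using that by blast
  qed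
  then show "partition_perm (extend_last_block n P) x = (partition_perm P \<circ> Transposition.transpose n (Suc n)) x"
  proof cases
    case 1
    then show ?thesis
      using partition_perm_interval[OF Q b 1] partition_perm_interval[OF P a(1)] PS a
      by (auto simp: Transposition.transpose_def)
  next
    case 2
    then obtain B where B: "B \<in> P" "x \<in> B" using partition_onD1[OF P] by blast
    then have "B \<noteq> {a..n}" using 2 by auto
    then have "B \<inter> {a..n} = {}"
      by (rule disjointD[OF partition_onD2[OF P] B(1) a(1)])
    then have "n \<notin> B" using a by auto
    then have "B \<in> extend_last_block n P" using B by (auto simp: extend_last_block_def)
    moreover have "x \<noteq> n" "x \<noteq> Suc n" using 2 a by auto
    ultimately show ?thesis
      using partition_perm_block[OF P B] partition_perm_block[OF Q _ B(2)] by simp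
  next
    case 3
    then have "partition_perm (extend_last_block n P) x = x" "x \<noteq> n" "x \<noteq> Suc n" "x \<notin> {1..n}"
      using permutes_not_in[OF partition_perm_permutes[OF Q finite_atLeastAtMost]] assms(2) by auto
    then show ?thesis using PS by simp
  qed
qed

section \<open>Evaluation of the double sum\<close>

lemma sum_interval_partitions_num_cycles:
  fixes x :: "'a::comm_semiring_1"
  assumes "n \<ge> 1"
  shows "(\<Sum>P\<in>interval_partitions n. \<Sum>Q\<in>interval_partitions n.
            x ^ num_cycles n (inv (partition_perm P) \<circ> partition_perm Q))
         = x * (2 + 2 * x) ^ (n - 1)"
  using assms
proof (induction n rule: nat_induct_at_least)
  case base
  show ?case by (simp add: interval_partitions_1[unfolded One_nat_def] num_cycles_def)
next
  case (Suc n)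
  let ?I = "interval_partitions n" and ?\<tau> = "Transposition.transpose n (Suc n)"
  let ?f = "\<lambda>m P Q. x ^ num_cycles m (inv (partition_perm P) \<circ> partition_perm Q)"
  \<comment> \<open>The summands belong, in this order, to \<sigma>, \<sigma>\<tau>, \<tau>\<sigma>
    and \<tau>\<sigma>\<tau>, and contribute the factors \<open>x\<close>, 1, 1 and
    \<open>x\<close>.\<close>
  have step: "?f (Suc n) (append_block n P) (append_block n Q)
        + ?f (Suc n) (append_block n P) (extend_last_block n Q)
        + (?f (Suc n) (extend_last_block n P) (append_block n Q)
        + ?f (Suc n) (extend_last_block n P) (extend_last_block n Q))
      = (2 + 2 * x) * ?f n P Q" if P: "P \<in> ?I" and Q: "Q \<in> ?I" for P Q
  proof -
    note pP = partition_perm_permutes[OF interval_partitions_D(1)[OF P] finite_atLeastAtMost]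
      and pQ = partition_perm_permutes[OF interval_partitions_D(1)[OF Q] finite_atLeastAtMost]
    define \<sigma> where "\<sigma> = inv (partition_perm P) \<circ> partition_perm Q"
    have \<sigma>: "\<sigma> permutes {1..n}"
      unfolding \<sigma>_def using pP pQ by (intro permutes_compose permutes_inv)
    have \<tau>: "?\<tau> permutes {1..Suc n}"
      using Suc.hyps by (intro permutes_swap_id) auto
    have inv: "inv (partition_perm P \<circ> ?\<tau>) = ?\<tau> \<circ> inv (partition_perm P)"
      using o_inv_distrib[OF permutes_bij[OF pP] permutes_bij[OF \<tau>]] by simp
    \<comment> \<open>As \<tau> is its own inverse, this is a conjugate of \<sigma>.\<close>
    have "num_cycles (Suc n) (?\<tau> \<circ> \<sigma> \<circ> ?\<tau>) = Suc (num_cycles n \<sigma>)"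
      using num_cycles_conj[OF \<tau>, of \<sigma>] num_cycles_Suc_fixed[OF \<sigma>] by simp
    then show ?thesis
      using num_cycles_Suc_fixed[OF \<sigma>] num_cycles_comp_transpose[OF \<sigma> Suc.hyps]
        num_cycles_transpose_comp[OF \<sigma> Suc.hyps]
      unfolding partition_perm_append_block[OF P] partition_perm_append_block[OF Q]
        partition_perm_extend_last_block[OF P Suc.hyps] partition_perm_extend_last_block[OF Q Suc.hyps] inv
      by (simp add: \<sigma>_def comp_assoc algebra_simps flip: mult_2)
  qed
  have "(\<Sum>P\<in>interval_partitions (Suc n). \<Sum>Q\<in>interval_partitions (Suc n). ?f (Suc n) P Q)
      = (\<Sum>P\<in>?I. \<Sum>Q\<in>?I. (2 + 2 * x) * ?f n P Q)"
    \<comment> \<open>The recursion splits the outer and the inner sum. Merging the results under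
      one double sum produces the left-hand side of \<open>step\<close>.\<close>
    unfolding sum_interval_partitions_Suc[OF Suc.hyps] sum.distrib[symmetric]
    by (intro sum.cong refl step)
  also have "\<dots> = (2 + 2 * x) * (x * (2 + 2 * x) ^ (n - 1))"
    unfolding sum_distrib_left[symmetric] Suc.IH ..
  also have "\<dots> = x * (2 + 2 * x) ^ (Suc n - 1)"
    using Suc.hyps by (cases n) (simp_all add: mult_ac)
  finally show ?case .
qed

section \<open>Powers of the matrix Z\<close>

lemma orthonormal_basis_rows:
  assumes "is_orthonormal_basis e"
  shows "(\<Sum>k\<in>UNIV. e i $ k * cnj (e j $ k)) = (if i = j then 1 else 0)"
  using assms by (simp add: is_orthonormal_basis_def)

text \<open>Orthonormality says that \<open>?U\<close> times its conjugate transpose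
  \<open>?V\<close> is the identity. For square matrices the product in the other order is then the
  identity too.\<close>

lemma orthonormal_basis_columns:
  fixes e :: "'l::finite \<Rightarrow> complex^'l"
  assumes "is_orthonormal_basis e"
  shows "(\<Sum>i\<in>UNIV. e i $ a * cnj (e i $ b)) = (if a = b then 1 else 0)"
proof -
  let ?U = "(\<chi> i a. e i $ a) :: complex^'l^'l" and ?V = "(\<chi> a i. cnj (e i $ a)) :: complex^'l^'l"
  have "?U ** ?V = mat 1"
    by (simp add: vec_eq_iff matrix_matrix_mult_def mat_def orthonormal_basis_rows[OF assms])
  then have "?V ** ?U = mat 1"
    by (simp add: matrix_left_right_inverse)
  then have "(?V ** ?U) $ b $ a = mat 1 $ b $ a" by simp
  then show ?thesis
    by (simp add: matrix_matrix_mult_def mat_def mult.commute eq_commute)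
qed

lemma Omega_nth: "Omega e $ (a, b) = (\<Sum>i\<in>UNIV. e i $ a * e i $ b)"
  by (simp add: Omega_def tensor_vec_def)

text \<open>This symmetry reduces the partial trace over the second factor to the one over the
  first.\<close>

lemma Omega_commute: "Omega e $ (a, b) = Omega e $ (b, a)"
  by (simp add: Omega_nth mult.commute)

text \<open>With the basis vectors as the rows of a unitary matrix \<open>U\<close>, the coefficient
  matrix is the transpose of \<open>U\<close> times \<open>U\<close>. Row orthonormality removes the
  sum over \<open>a\<close>, and column orthonormality evaluates the rest.\<close>

lemma Omega_unitary:
  fixes e :: "'l::finite \<Rightarrow> complex^'l"
  assumes "is_orthonormal_basis e"
  shows "(\<Sum>a\<in>UNIV. Omega e $ (a, b) * cnj (Omega e $ (a, c))) = (if b = c then 1 else 0)"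
proof -
  have "(\<Sum>a\<in>UNIV. Omega e $ (a, b) * cnj (Omega e $ (a, c)))
      = (\<Sum>a\<in>UNIV. \<Sum>i\<in>UNIV. \<Sum>j\<in>UNIV. e i $ b * cnj (e j $ c) * (e i $ a * cnj (e j $ a)))"
    by (simp add: Omega_nth sum_product mult_ac)
  also have "\<dots> = (\<Sum>i\<in>UNIV. \<Sum>j\<in>UNIV. e i $ b * cnj (e j $ c) * (\<Sum>a\<in>UNIV. e i $ a * cnj (e j $ a)))"
    unfolding sum_distrib_left by (subst sum.swap, rule sum.cong[OF refl], rule sum.swap)
  also have "\<dots> = (\<Sum>i\<in>UNIV. e i $ b * cnj (e i $ c))"
    by (simp add: orthonormal_basis_rows[OF assms] if_distrib cong: if_cong)
  finally show ?thesis
    by (simp add: orthonormal_basis_columns[OF assms])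
qed

lemma Omega_norm:
  fixes e :: "'l::finite \<Rightarrow> complex^'l"
  assumes "is_orthonormal_basis e"
  shows "(\<Sum>p\<in>UNIV. Omega e $ p * cnj (Omega e $ p)) = of_nat CARD('l)"
proof -
  have "(\<Sum>p\<in>UNIV. Omega e $ p * cnj (Omega e $ p))
      = (\<Sum>a\<in>UNIV. \<Sum>b\<in>UNIV. Omega e $ (a, b) * cnj (Omega e $ (a, b)))"
    by (simp add: sum.cartesian_product UNIV_Times_UNIV split_def)
  also have "\<dots> = (\<Sum>b\<in>UNIV. \<Sum>a\<in>UNIV. Omega e $ (a, b) * cnj (Omega e $ (a, b)))"
    by (rule sum.swap)
  finally show ?thesis
    by (simp add: Omega_unitary[OF assms])
qed

section \<open>The map \<open>Psi\<close> on both tensor factors, in coordinates\<close>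

lemma Psi_mat_unit_nth:
  "Psi (mat_unit i j) $ a $ b =
     (if a = i then if b = j then 1 else 0 else 0) + (if i = j then if a = b then 1 else 0 else 0)"
proof -
  have "trace (mat_unit i j) = (if i = j then 1 else 0)"
    by (cases "i = j") (auto simp: trace_def mat_unit_def intro: sum.neutral)
  then show ?thesis
    by (simp add: Psi_def mat_unit_def mat_def)
qed

text \<open>Expanding the product of two maps of the form identity plus trace gives four terms: the
  matrix itself, its two partial traces and its full trace.\<close>

lemma tensor_map_Psi_Psi_nth:
  fixes X :: "complex^('l::finite \<times> 'l)^('l \<times> 'l)"
  shows "tensor_map Psi Psi X $ (a, c) $ (b, d) =
     X $ (a, c) $ (b, d)
     + (if c = d then \<Sum>k\<in>UNIV. X $ (a, k) $ (b, k) else 0)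
     + (if a = b then \<Sum>i\<in>UNIV. X $ (i, c) $ (i, d) else 0)
     + (if a = b \<and> c = d then trace X else 0)"
proof -
  \<comment> \<open>This is \<open>Psi\<close> on one factor, for an arbitrary coefficient array
    \<open>Y\<close>. It is used twice: for the inner sums over the second factor, then for the
    outer sums over the first.\<close>
  have km: "(\<Sum>k\<in>UNIV. \<Sum>m\<in>UNIV. Y k m * Psi (mat_unit k m) $ c $ d)
      = Y c d + (if c = d then \<Sum>k\<in>UNIV. Y k k else 0)" for Y :: "'l \<Rightarrow> 'l \<Rightarrow> complex" and c d
  proof -
    have m: "(\<Sum>m\<in>UNIV. Y k m * Psi (mat_unit k m) $ c $ d)
        = (if c = k then Y k d else 0) + (if c = d then Y k k else 0)" for k
      by (cases "c = k"; cases "c = d")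
         (simp_all add: Psi_mat_unit_nth distrib_left sum.distrib if_distrib[of "\<lambda>x. _ * x"] cong: if_cong)
    show ?thesis
      unfolding m sum.distrib by simp
  qed
  have "tensor_map Psi Psi X $ (a, c) $ (b, d) =
     (\<Sum>i\<in>UNIV. \<Sum>j\<in>UNIV. (\<Sum>k\<in>UNIV. \<Sum>m\<in>UNIV.
        X $ (i, k) $ (j, m) * Psi (mat_unit k m) $ c $ d) * Psi (mat_unit i j) $ a $ b)"
    by (simp add: tensor_map_def tensor_mat_def sum_distrib_left mult_ac)
  also have "\<dots> = X $ (a, c) $ (b, d) + (if c = d then \<Sum>k\<in>UNIV. X $ (a, k) $ (b, k) else 0)
     + (if a = b then \<Sum>i\<in>UNIV. X $ (i, c) $ (i, d) + (if c = d then \<Sum>k\<in>UNIV. X $ (i, k) $ (i, k) else 0) else 0)"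
    unfolding km ..
  finally have eq: "tensor_map Psi Psi X $ (a, c) $ (b, d) = \<dots>" .
  have "(\<Sum>i\<in>UNIV. \<Sum>k\<in>UNIV. X $ (i, k) $ (i, k)) = trace X"
    by (simp add: trace_def sum.cartesian_product UNIV_Times_UNIV split_def)
  then show ?thesis
    unfolding eq by (simp add: sum.distrib)
qed

text \<open>Each partial trace of \<open>omega e\<close> contributes one identity matrix, and the
  full trace contributes \<open>CARD('l)\<close> of them.\<close>

lemma tensor_map_Psi_Psi_omega:
  fixes e :: "'l::finite \<Rightarrow> complex^'l"
  assumes "is_orthonormal_basis e"
  shows "tensor_map Psi Psi (omega e) = omega e + mat (2 + of_nat CARD('l))"
proof -
  have t: "trace (omega e) = of_nat CARD('l)"
    by (simp add: trace_def omega_def Omega_norm[OF assms])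
  have l: "(\<Sum>i\<in>UNIV. omega e $ (i, c) $ (i, d)) = (if c = d then 1 else 0)" for c d
    by (simp add: omega_def Omega_unitary[OF assms])
  have r: "(\<Sum>k\<in>UNIV. omega e $ (a, k) $ (b, k)) = (if a = b then 1 else 0)" for a b
    using l[of a b] by (simp add: omega_def Omega_commute)
  show ?thesis
    unfolding vec_eq_iff split_paired_all
    by (simp add: tensor_map_Psi_Psi_nth t l r mat_def split_paired_All)
qed

section \<open>Products of \<open>omega\<close> with powers of Z\<close>

lemma omega_mult_omega:
  fixes e :: "'l::finite \<Rightarrow> complex^'l"
  assumes "is_orthonormal_basis e"
  shows "omega e ** omega e = mat (of_nat CARD('l)) ** omega e"
proof -
  have "(omega e ** omega e) $ p $ q = of_nat CARD('l) * omega e $ p $ q" for p q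
  proof -
    \<comment> \<open>The inner factor of \<Omega>\<Omega>*\<Omega>\<Omega>* is the squared norm of
      \<Omega>, which is \<open>CARD('l)\<close>.\<close>
    have "(omega e ** omega e) $ p $ q
        = Omega e $ p * cnj (Omega e $ q) * (\<Sum>r\<in>UNIV. Omega e $ r * cnj (Omega e $ r))"
      by (simp add: matrix_matrix_mult_def omega_def sum_distrib_left mult_ac)
    then show ?thesis
      by (simp add: Omega_norm[OF assms] omega_def mult_ac)
  qed
  then show ?thesis
    by (simp add: vec_eq_iff mat_scalar_nth)
qed

lemma matrix_mult_mat_commute: "(A :: complex^'m^'m) ** mat c = mat c ** A"
  by (simp add: vec_eq_iff mat_scalar_nth)
     (simp add: matrix_matrix_mult_def mat_def if_distrib[of "\<lambda>x. _ * x"] mult.commute cong: if_cong)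

lemma mat_mult_mat: "mat c ** mat d = (mat (c * d) :: complex^'m^'m)"
  by (simp add: vec_eq_iff mat_scalar_nth) (simp add: mat_def)

text \<open>Each factor \<open>?Z\<close> next to \<open>omega e\<close> is absorbed as the scalar l
  + (2 + l), where l is the dimension.\<close>

lemma omega_mult_mat_power:
  fixes e :: "'l::finite \<Rightarrow> complex^'l"
  assumes "is_orthonormal_basis e"
  shows "omega e ** mat_power (omega e + mat (2 + of_nat CARD('l))) k
       = mat ((2 + 2 * of_nat CARD('l)) ^ k) ** omega e"
proof (induction k)
  case 0
  show ?case by simp
next
  case (Suc k)
  let ?l = "of_nat CARD('l) :: complex"
  let ?Z = "omega e + mat (2 + ?l)"
  have "omega e ** ?Z = mat (2 + 2 * ?l) ** omega e"
    by (simp add: matrix_add_ldistrib omega_mult_omega[OF assms] matrix_mult_mat_commute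
        vec_eq_iff mat_scalar_nth algebra_simps)
  then have "omega e ** mat_power ?Z (Suc k) = mat (2 + 2 * ?l) ** (omega e ** mat_power ?Z k)"
    by (simp add: matrix_mul_assoc)
  also have "\<dots> = mat ((2 + 2 * ?l) ^ Suc k) ** omega e"
    by (simp add: Suc.IH matrix_mul_assoc mat_mult_mat)
  finally show ?case .
qed

lemma trace_omega_mult_mat_power:
  fixes e :: "'l::finite \<Rightarrow> complex^'l"
  assumes "is_orthonormal_basis e"
  shows "trace (omega e ** mat_power (tensor_map Psi Psi (omega e)) k)
       = of_nat CARD('l) * (2 + 2 * of_nat CARD('l)) ^ k"
proof -
  have "trace (mat c ** omega e) = c * of_nat CARD('l)" for c
    unfolding trace_def mat_scalar_nth sum_distrib_left[symmetric]
    by (simp add: omega_def Omega_norm[OF assms])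
  then show ?thesis
    by (simp add: tensor_map_Psi_Psi_omega[OF assms] omega_mult_mat_power[OF assms] mult.commute)
qed

theorem theorem7p7:
  fixes e :: "'l::finite \<Rightarrow> complex^'l"
    and Z :: "complex^('l \<times> 'l)^('l \<times> 'l)"
    and n :: nat
  assumes "is_orthonormal_basis e"
    and "Z = tensor_map Psi Psi (omega e)"
    and "n \<ge> 1"
  shows "(\<Sum>P\<in>interval_partitions n. \<Sum>Q\<in>interval_partitions n.
            of_nat CARD('l) ^ num_cycles n (inv (partition_perm P) \<circ> partition_perm Q))
         = trace (omega e ** mat_power Z (n - 1))
       \<and> trace (omega e ** mat_power Z (n - 1))
         = of_nat CARD('l) * (2 + 2 * of_nat CARD('l)) ^ (n - 1)"
  \<comment> \<open>Both the double sum, taken at \<open>x = of_nat CARD('l)\<close>, and the trace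
    turn into the same closed form.\<close>
  unfolding assms(2) trace_omega_mult_mat_power[OF assms(1)]
    sum_interval_partitions_num_cycles[OF assms(3)]
  by simp

end
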